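(* Let $\alpha=(a,b,A,B)\in\mathcal A_n$ be an arc with $b-a\ge 2$ and let $x\in\,]a,b[$. Then $$\mathrm{SP}(\alpha_x^A)+\mathrm{SP}(\alpha_x^B)=\mathrm{SP}(\alpha_{\bar x})+\mathrm{SP}(\alpha_{\le x})+\mathrm{SP}(\alpha_{\ge x})$$ (Minkowski sums), where $\alpha_x^A=(a,b,A\cup\{x\},B\setminus\{x\})$, $\alpha_x^B=(a,b,A\setminus\{x\},B\cup\{x\})$, $\alpha_{\bar x}=(a,b,A\setminus\{x\},B\setminus\{x\})$ (a pseudoshard), $\alpha_{\le x}=(a,x,A\cap]a,x[,B\cap]a,x[)$ and $\alpha_{\ge x}=(x,b,A\cap]x,b[,B\cap]x,b[)$.
   Context: $]a,b[=\{a+1,\dots,b-1\}$, $(\mathbf e_i)$ the standard basis of $\mathbb R^n$. An arc is a quadruple $(a,b,A,B)$ with $1\le a<b\le n$ and $A\sqcup B=]a,b[$; $\mathcal A_n$ is the set of arcs. More generally a pseudoshard is a quadruple $\alpha=(a,b,A,B)$ with $1\le a<b\le n$ and $A,B$ disjoint subsets of $]a,b[$ (not necessarily covering $]a,b[$). For such $\alpha$, an $\alpha$-alternating matching is a (possibly empty) set $M=\{a_1<b_1<\dots<a_k<b_k\}$ with $a\le a_1$, $b_k\le b$, $a_i\in\{a\}\cup A$, $b_i\in B\cup\{b\}$ (so elements of $]a,b[\setminus(A\cup B)$ are never used); $\chi(M)=\sum_i(\mathbf e_{a_i}-\mathbf e_{b_i})$; and $\mathrm{SP}(\alpha)=\mathrm{conv}\{\chi(M):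 M\ \alpha\text{-alternating matching}\}$. *)

theory Defs
  imports "HOL-Analysis.Analysis" "HOL-Library.Set_Algebras"
begin

text \<open>
  Positions are the natural numbers \<open>1, \<dots>, n\<close> with \<open>n = CARD('n)\<close>, and the ambient space is
  \<open>real ^ 'n\<close>. The index type carries no order, so its elements are numbered by
  \<^const>\<open>from_nat_into\<close>, which is a bijection from \<open>{..<CARD('n)}\<close> onto \<^term>\<open>UNIV :: 'n set\<close>.
  Only \<open>std_basis i\<close> with \<open>1 \<le> i \<le> CARD('n)\<close> is meaningful.
\<close>

definition std_basis :: "nat \<Rightarrow> real ^ 'n::finite" where
  "std_basis i = axis (from_nat_into (UNIV :: 'n set) (i - 1)) 1"

lemma bij_betw_std_basis:
  "bij_betw (std_basis :: nat \<Rightarrow> real ^ 'n::finite) {1..CARD('n)} Basis"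
proof -
  have 1: "bij_betw (\<lambda>i. i - 1) {1..CARD('n)} {..<CARD('n)}"
    by (rule bij_betwI[where g = Suc]) auto
  have 2: "bij_betw (from_nat_into (UNIV :: 'n set)) {..<CARD('n)} UNIV"
    by (rule bij_betw_from_nat_into_finite) simp
  have 3: "bij_betw (\<lambda>j. axis j 1 :: real ^ 'n) UNIV Basis"
    by (auto simp: bij_betw_def inj_on_def axis_eq_axis Basis_vec_def)
  show ?thesis
    using bij_betw_trans[OF bij_betw_trans[OF 1 2] 3]
    by (simp add: std_basis_def comp_def fun_eq_iff[symmetric] cong: bij_betw_cong)
qed

type_synonym quad = "nat \<times> nat \<times> nat set \<times> nat set"

definition arcs :: "nat \<Rightarrow> quad set" where
  "arcs n = {(a, b, A, B). 1 \<le> a \<and> a < b \<and> b \<le> n \<and> A \<inter> B = {} \<and> A \<union> B = {a<..<b}}"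

definition pseudoshards :: "nat \<Rightarrow> quad set" where
  "pseudoshards n = {(a, b, A, B). 1 \<le> a \<and> a < b \<and> b \<le> n \<and>
     A \<inter> B = {} \<and> A \<subseteq> {a<..<b} \<and> B \<subseteq> {a<..<b}}"

text \<open>
  Writing the sorted list of a finite set \<open>M\<close> as \<open>a\<^sub>1 < b\<^sub>1 < \<dots> < a\<^sub>k < b\<^sub>k\<close>, the element \<open>a\<^sub>i\<close> sits
  at list position \<open>2 * (i - 1)\<close> and \<open>b\<^sub>i\<close> at \<open>2 * (i - 1) + 1\<close>.
  Below, \<open>i\<close> ranges over \<open>{..<k}\<close>.
\<close>

definition alternating_matching :: "quad \<Rightarrow> nat set \<Rightarrow> bool" where
  "alternating_matching = (\<lambda>(a, b, A, B) M.
     finite M \<and> even (card M) \<and> M \<subseteq> {a..b} \<and>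
     (\<forall>i < card M div 2.
        sorted_list_of_set M ! (2 * i) \<in> {a} \<union> A \<and>
        sorted_list_of_set M ! (2 * i + 1) \<in> B \<union> {b}))"

definition chi :: "nat set \<Rightarrow> real ^ 'n::finite" where
  "chi M = (\<Sum>i < card M div 2.
     std_basis (sorted_list_of_set M ! (2 * i)) - std_basis (sorted_list_of_set M ! (2 * i + 1)))"

definition SP :: "quad \<Rightarrow> (real ^ 'n::finite) set" where
  "SP \<alpha> = convex hull {chi M |M. alternating_matching \<alpha> M}"

lemma arcs_subset_pseudoshards: "arcs n \<subseteq> pseudoshards n"
  by (auto simp: arcs_def pseudoshards_def)

lemma derived_pseudoshards:
  assumes "(a, b, A, B) \<in> arcs n" and "x \<in> {a<..<b}"
  shows "(a, b, A \<union> {x}, B - {x}) \<in> arcs n"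
    and "(a, b, A - {x}, B \<union> {x}) \<in> arcs n"
    and "(a, b, A - {x}, B - {x}) \<in> pseudoshards n"
    and "(a, x, A \<inter> {a<..<x}, B \<inter> {a<..<x}) \<in> arcs n"
    and "(x, b, A \<inter> {x<..<b}, B \<inter> {x<..<b}) \<in> arcs n"
  using assms by (auto simp: arcs_def pseudoshards_def)

end

theory Submission
  imports Defs
begin

text \<open>
  The partial sums of \<open>\<chi>(M)\<close> are the indicator function of a set \<open>F \<subseteq> {a..<b}\<close>, which may be
  entered only at \<open>a\<close> or at a point of \<open>A\<close> and left only at a point of \<open>B\<close> or at \<open>b\<close>.
  In these terms, the identity already holds for the generating sets, before taking convex hulls.
  Cut \<open>F = G \<union> H\<close> and \<open>F' = G' \<union> H'\<close> at \<open>x\<close>, where \<open>F\<close> may be entered but not left at \<open>x\<close> and \<open>F'\<close>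
  may be left but not entered. If both changes occur, then exchanging \<open>H\<close> and \<open>H'\<close> removes them
  both; otherwise one of \<open>F\<close>, \<open>F'\<close> is already constant at \<open>x\<close>. Conversely, any \<open>G \<union> H\<close> satisfies
  one of the two conditions at \<open>x\<close>, and a set constant at \<open>x\<close> satisfies both.
\<close>

definition step_sets :: "quad \<Rightarrow> nat set set" where
  "step_sets = (\<lambda>(a, b, A, B). {F. F \<subseteq> {a..<b} \<and>
     (\<forall>i\<in>{a<..<b}. (i \<in> F \<and> i - 1 \<notin> F \<longrightarrow> i \<in> A) \<and> (i \<notin> F \<and> i - 1 \<in> F \<longrightarrow> i \<in> B))})"

text \<open>A single \<open>std_basis i - std_basis (Suc i)\<close> has partial sum 1 exactly at
  position \<open>i\<close>, so this is the vector whose partial sums form the indicator function of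
  \<open>F\<close>.\<close>

definition step_vec :: "nat set \<Rightarrow> real ^ 'n::finite" where
  "step_vec F = (\<Sum>i\<in>F. std_basis i - std_basis (Suc i))"

text \<open>For a matching with elements a_1 < b_1 < ... < a_k < b_k this is the union of the
  half-open intervals from a_i to b_i, the positions where the partial sum of \<open>chi M\<close>
  is 1.\<close>

definition odd_rank_set :: "nat set \<Rightarrow> nat set" where
  "odd_rank_set M = {i. odd (card {j\<in>M. j \<le> i})}"

definition jump_set :: "nat set \<Rightarrow> nat set" where
  "jump_set F = {i. i > 0 \<and> (i \<in> F) \<noteq> (i - 1 \<in> F)}"

section \<open>Ranks in place of list positions\<close>

lemma card_less_nth_sorted_list_of_set:
  fixes M :: "'a::linorder set"
  assumes "finite M" "i < card M"
  shows "card {j\<in>M. j < sorted_list_of_set M ! i} = i"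
proof -
  let ?xs = "sorted_list_of_set M"
  have xs: "sorted_wrt (<) ?xs" "set ?xs = M" "length ?xs = card M"
    using assms by auto
  have "{j\<in>M. j < ?xs ! i} = (!) ?xs ` {..<i}"
  proof (intro equalityI subsetI)
    fix j assume "j \<in> {j\<in>M. j < ?xs ! i}"
    then obtain k where k: "k < card M" "j = ?xs ! k" "?xs ! k < ?xs ! i"
      using xs by (metis (no_types, lifting) in_set_conv_nth mem_Collect_eq)
    have "k < i"
      using k xs assms by (metis linorder_neqE_nat not_less_iff_gr_or_eq sorted_wrt_nth_less)
    then show "j \<in> (!) ?xs ` {..<i}" using k by auto
  next
    fix j assume "j \<in> (!) ?xs ` {..<i}"
    then obtain k where k: "k < i" "j = ?xs ! k" by auto
    then show "j \<in> {j\<in>M. j < ?xs ! i}"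
      using xs assms by (metis (no_types, lifting) dual_order.strict_trans mem_Collect_eq nth_mem sorted_wrt_nth_less)
  qed
  moreover have "inj_on ((!) ?xs) {..<i}"
    using assms xs by (intro inj_on_nth) auto
  ultimately show ?thesis by (simp add: card_image)
qed

lemma bij_betw_nth_sorted_list_of_set:
  assumes "finite M"
  shows "bij_betw ((!) (sorted_list_of_set M)) {..<card M} M"
  using assms by (intro bij_betw_nth) auto

lemma alternating_matching_iff_rank:
  "alternating_matching (a, b, A, B) M \<longleftrightarrow>
     finite M \<and> even (card M) \<and> M \<subseteq> {a..b} \<and>
     (\<forall>m\<in>M. if even (card {j\<in>M. j < m}) then m \<in> {a} \<union> A else m \<in> B \<union> {b})"
proof (cases "finite M \<and> even (card M)")
  case True
  let ?xs = "sorted_list_of_set M"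
  let ?P = "\<lambda>i m. if even i then m \<in> {a} \<union> A else m \<in> B \<union> {b}"
  have surj: "(!) ?xs ` {..<card M} = M"
    using bij_betw_imp_surj_on[OF bij_betw_nth_sorted_list_of_set] True by blast
  have "(\<forall>m\<in>(!) ?xs ` {..<card M}. Q m) \<longleftrightarrow> (\<forall>i\<in>{..<card M}. Q (?xs ! i))" for Q
    by blast
  from this[unfolded surj] have "(\<forall>m\<in>M. ?P (card {j\<in>M. j < m}) m) \<longleftrightarrow>
      (\<forall>i\<in>{..<card M}. ?P (card {j\<in>M. j < ?xs ! i}) (?xs ! i))" .
  also have "\<dots> \<longleftrightarrow> (\<forall>i<card M. ?P i (?xs ! i))"
    using True by (auto simp: card_less_nth_sorted_list_of_set)
  \<comment> \<open>Indices are grouped into pairs \<open>2 * i\<close>, \<open>2 * i + 1\<close>;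
    as \<open>card M\<close> is even, no index is left over.\<close>
  also have "\<dots> \<longleftrightarrow> (\<forall>i<card M div 2. ?P (2 * i) (?xs ! (2 * i)) \<and> ?P (2 * i + 1) (?xs ! (2 * i + 1)))"
  proof (intro iffI allI impI)
    fix i assume *: "\<forall>i<card M. ?P i (?xs ! i)" and "i < card M div 2"
    then have "2 * i < card M" "2 * i + 1 < card M" using True by auto
    with * show "?P (2 * i) (?xs ! (2 * i)) \<and> ?P (2 * i + 1) (?xs ! (2 * i + 1))" by blast
  next
    fix i assume *: "\<forall>i<card M div 2. ?P (2 * i) (?xs ! (2 * i)) \<and> ?P (2 * i + 1) (?xs ! (2 * i + 1))"
      and "i < card M"
    then have "i div 2 < card M div 2" using True by auto
    with * have "?P (2 * (i div 2)) (?xs ! (2 * (i div 2)))"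
      "?P (2 * (i div 2) + 1) (?xs ! (2 * (i div 2) + 1))" by blast+
    then show "?P i (?xs ! i)" by (cases "even i") auto
  qed
  finally show ?thesis
    using True unfolding alternating_matching_def by simp
qed (auto simp: alternating_matching_def)

lemma sum_even_odd_pairs:
  fixes f :: "nat \<Rightarrow> 'a::comm_monoid_add"
  shows "(\<Sum>i<2 * k. f i) = (\<Sum>i<k. f (2 * i) + f (2 * i + 1))"
  by (induction k) (auto simp: add.assoc)

lemma chi_eq_rank_sum:
  assumes "finite M" "even (card M)"
  shows "chi M = (\<Sum>m\<in>M. (-1) ^ card {j\<in>M. j < m} *\<^sub>R std_basis m)"
proof -
  let ?xs = "sorted_list_of_set M"
  have "chi M = (\<Sum>i<2 * (card M div 2). (-1) ^ i *\<^sub>R (std_basis (?xs ! i) :: real ^ 'n))"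
    unfolding chi_def sum_even_odd_pairs by simp
  also have "\<dots> = (\<Sum>i<card M. (-1) ^ card {j\<in>M. j < ?xs ! i} *\<^sub>R std_basis (?xs ! i))"
    using assms by (simp add: card_less_nth_sorted_list_of_set)
  also have "\<dots> = (\<Sum>m\<in>M. (-1) ^ card {j\<in>M. j < m} *\<^sub>R std_basis m)"
    by (rule sum.reindex_bij_betw[OF bij_betw_nth_sorted_list_of_set[OF assms(1)]])
  finally show ?thesis .
qed

section \<open>Matchings correspond to step sets\<close>

lemma card_le_eq_card_less:
  fixes M :: "nat set"
  assumes "finite M"
  shows "card {j\<in>M. j \<le> i} = card {j\<in>M. j < i} + of_bool (i \<in> M)"
proof (cases "i \<in> M")
  case True
  then have "{j\<in>M. j \<le> i} = insert i {j\<in>M. j < i}" by auto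
  then show ?thesis using assms True by simp
next
  case False
  then have "{j\<in>M. j \<le> i} = {j\<in>M. j < i}" by (auto simp: order_le_less)
  then show ?thesis using False by simp
qed

lemma mem_odd_rank_set:
  assumes "finite M"
  shows "i \<in> odd_rank_set M \<longleftrightarrow>
    (if i \<in> M then even (card {j\<in>M. j < i}) else odd (card {j\<in>M. j < i}))"
  unfolding odd_rank_set_def mem_Collect_eq card_le_eq_card_less[OF assms]
  by (simp only: even_add) auto

text \<open>Compared with \<open>mem_odd_rank_set\<close>, this locates the changes:
  \<open>odd_rank_set M\<close> is entered at the elements of \<open>M\<close> of even rank, left at
  those of odd rank, and constant elsewhere.\<close>

lemma pred_mem_odd_rank_set:
  assumes "i > 0"
  shows "i - 1 \<in> odd_rank_set M \<longleftrightarrow> odd (card {j\<in>M. j < i})"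
proof -
  have "{j\<in>M. j \<le> i - 1} = {j\<in>M. j < i}" using assms by auto
  then show ?thesis by (simp add: odd_rank_set_def)
qed

text \<open>An odd count is neither 0 nor the even number \<open>card M\<close>, so \<open>M\<close>
  has elements on both sides of \<open>i\<close>.\<close>

lemma odd_rank_set_subset:
  assumes "even (card M)" "M \<subseteq> {a..b}"
  shows "odd_rank_set M \<subseteq> {a..<b}"
proof
  fix i assume "i \<in> odd_rank_set M"
  then have "odd (card {j\<in>M. j \<le> i})" by (simp add: odd_rank_set_def)
  then have "{j\<in>M. j \<le> i} \<noteq> {}" "{j\<in>M. j \<le> i} \<noteq> M"
    using assms(1) by (auto simp del: Collect_empty_eq)
  then have "\<exists>j\<in>M. j \<le> i" "\<exists>k\<in>M. i < k" by (auto simp: not_le[symmetric])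
  then show "i \<in> {a..<b}" using assms(2) by fastforce
qed

text \<open>Summation by parts: the sign of \<open>m\<close> in \<open>chi M\<close> is the
  increment of the indicator of \<open>odd_rank_set M\<close> from \<open>m - 1\<close> to
  \<open>m\<close>.\<close>

lemma chi_eq_step_vec:
  assumes "finite M" "even (card M)" "0 \<notin> M"
  shows "chi M = step_vec (odd_rank_set M)"
proof -
  let ?F = "odd_rank_set M"
  obtain b where "\<forall>m\<in>M. m \<le> b"
    using assms(1) by (auto simp: finite_nat_set_iff_bounded_le)
  then have b: "M \<subseteq> {1..b}"
    using assms(3) by (force simp: Suc_le_eq intro!: gr0I)
  have F: "?F \<subseteq> {1..<b}" using odd_rank_set_subset[OF assms(2) b] .
  have "chi M = (\<Sum>m\<in>M. (of_bool (m \<in> ?F) - of_bool (m - 1 \<in> ?F)) *\<^sub>R (std_basis m :: real ^ 'n))"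
    unfolding chi_eq_rank_sum[OF assms(1,2)]
  proof (rule sum.cong[OF refl])
    fix m assume m: "m \<in> M"
    with assms have "m > 0" by (cases m) auto
    from mem_odd_rank_set[OF assms(1), of m] pred_mem_odd_rank_set[OF this, of M] m
    show "(-1) ^ card {j\<in>M. j < m} *\<^sub>R (std_basis m :: real ^ 'n) =
        (of_bool (m \<in> ?F) - of_bool (m - 1 \<in> ?F)) *\<^sub>R std_basis m"
      by (cases "even (card {j\<in>M. j < m})") simp_all
  qed
  \<comment> \<open>Outside \<open>M\<close> the increment vanishes. Over a full interval the two
    halves of the increment can be summed separately, the second after an index shift.\<close>
  also have "\<dots> = (\<Sum>m\<in>{1..b}. (of_bool (m \<in> ?F) - of_bool (m - 1 \<in> ?F)) *\<^sub>R std_basis m)"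
  proof (rule sum.mono_neutral_left)
    show "\<forall>i\<in>{1..b} - M. (of_bool (i \<in> ?F) - of_bool (i - 1 \<in> ?F)) *\<^sub>R (std_basis i :: real ^ 'n) = 0"
    proof
      fix i assume i: "i \<in> {1..b} - M"
      then have "i > 0" by simp
      from mem_odd_rank_set[OF assms(1), of i] pred_mem_odd_rank_set[OF this, of M] i
      show "(of_bool (i \<in> ?F) - of_bool (i - 1 \<in> ?F)) *\<^sub>R (std_basis i :: real ^ 'n) = 0"
        by simp
    qed
  qed (use b in auto)
  also have "\<dots> = (\<Sum>m\<in>{1..b}. of_bool (m \<in> ?F) *\<^sub>R std_basis m)
      - (\<Sum>m\<in>{1..b}. of_bool (m - 1 \<in> ?F) *\<^sub>R std_basis m)"
    by (simp add: algebra_simps sum_subtractf)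
  also have "(\<Sum>m\<in>{1..b}. of_bool (m \<in> ?F) *\<^sub>R (std_basis m :: real ^ 'n)) = (\<Sum>m\<in>?F. std_basis m)"
    by (rule sum.mono_neutral_cong_right) (use F in auto)
  also have "(\<Sum>m\<in>{1..b}. of_bool (m - 1 \<in> ?F) *\<^sub>R (std_basis m :: real ^ 'n))
      = (\<Sum>m\<in>Suc ` ?F. std_basis m)"
  proof (rule sum.mono_neutral_cong_right)
    show "\<forall>i\<in>{1..b} - Suc ` ?F. of_bool (i - 1 \<in> ?F) *\<^sub>R (std_basis i :: real ^ 'n) = 0"
    proof
      fix i assume "i \<in> {1..b} - Suc ` ?F"
      then have "i - 1 \<notin> ?F" by (cases i) auto
      then show "of_bool (i - 1 \<in> ?F) *\<^sub>R (std_basis i :: real ^ 'n) = 0" by simp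
    qed
  qed (use F in auto)
  also have "\<dots> = (\<Sum>m\<in>?F. std_basis (Suc m))"
    by (simp add: sum.reindex)
  finally show ?thesis by (simp add: step_vec_def sum_subtractf)
qed

text \<open>Starting outside \<open>F\<close> at 0, each jump toggles membership, so the parity of
  the number of jumps up to \<open>i\<close> decides whether \<open>i\<close> is in
  \<open>F\<close>.\<close>

lemma odd_rank_set_jump_set:
  assumes "0 \<notin> F"
  shows "odd_rank_set (jump_set F) = F"
proof -
  have "i \<in> odd_rank_set (jump_set F) \<longleftrightarrow> i \<in> F" for i
  proof (induction i)
    case 0
    have no_jump: "{j \<in> jump_set F. j \<le> 0} = {}" by (auto simp: jump_set_def)
    have "0 \<notin> odd_rank_set (jump_set F)"
      unfolding odd_rank_set_def mem_Collect_eq no_jump by simp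
    then show ?case using assms by blast
  next
    case (Suc i)
    have "{j \<in> jump_set F. j \<le> Suc i} = {j \<in> jump_set F. j \<le> i} \<union> (if Suc i \<in> jump_set F then {Suc i} else {})"
      by (auto simp: le_Suc_eq)
    then have "card {j \<in> jump_set F. j \<le> Suc i} = card {j \<in> jump_set F. j \<le> i} + of_bool (Suc i \<in> jump_set F)"
      by simp
    then have "Suc i \<in> odd_rank_set (jump_set F) \<longleftrightarrow>
        (i \<in> odd_rank_set (jump_set F)) \<noteq> (Suc i \<in> jump_set F)"
      by (simp add: odd_rank_set_def)
    then show ?case unfolding Suc.IH by (auto simp: jump_set_def)
  qed
  then show ?thesis by blast
qed

lemma alternating_matching_odd_rank_set:
  assumes "alternating_matching (a, b, A, B) M"
  shows "odd_rank_set M \<in> step_sets (a, b, A, B)"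
proof -
  have M: "finite M" "even (card M)" "M \<subseteq> {a..b}"
    and r: "\<And>m. m \<in> M \<Longrightarrow> if even (card {j\<in>M. j < m}) then m \<in> {a} \<union> A else m \<in> B \<union> {b}"
    using assms unfolding alternating_matching_iff_rank by blast+
  have "(i \<in> odd_rank_set M \<and> i - 1 \<notin> odd_rank_set M \<longrightarrow> i \<in> A) \<and>
      (i \<notin> odd_rank_set M \<and> i - 1 \<in> odd_rank_set M \<longrightarrow> i \<in> B)" if "i \<in> {a<..<b}" for i
  proof -
    \<comment> \<open>Away from the endpoints, the alternatives \<open>{a}\<close> and
      \<open>{b}\<close> of the rank condition disappear.\<close>
    have "i > 0" "i \<noteq> a" "i \<noteq> b" using that by auto
    then show ?thesis
      using r[of i] mem_odd_rank_set[OF M(1), of i] pred_mem_odd_rank_set[of i M]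
      by (auto simp del: One_nat_def split: if_splits)
  qed
  then show ?thesis
    using odd_rank_set_subset[OF M(2,3)] by (simp add: step_sets_def)
qed

lemma alternating_matching_jump_set:
  assumes "F \<in> step_sets (a, b, A, B)" "1 \<le> a"
  shows "alternating_matching (a, b, A, B) (jump_set F)"
proof -
  let ?M = "jump_set F"
  have F: "F \<subseteq> {a..<b}"
    and s: "\<And>i. i \<in> {a<..<b} \<Longrightarrow> (i \<in> F \<and> i - 1 \<notin> F \<longrightarrow> i \<in> A) \<and> (i \<notin> F \<and> i - 1 \<in> F \<longrightarrow> i \<in> B)"
    using assms unfolding step_sets_def by auto
  have ror: "odd_rank_set ?M = F"
    using F assms(2) by (intro odd_rank_set_jump_set) auto
  have sub: "?M \<subseteq> {a..b}"
  proof
    fix i assume "i \<in> ?M"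
    then have "i \<in> {a..<b} \<or> i - 1 \<in> {a..<b}" using F unfolding jump_set_def by blast
    then show "i \<in> {a..b}" by auto
  qed
  then have fin: "finite ?M" using finite_subset by blast
  \<comment> \<open>All jumps are at most \<open>b\<close> and \<open>F\<close> has been left at
    \<open>b\<close>, so their total number is even.\<close>
  have "{j\<in>?M. j \<le> b} = ?M" using sub by auto
  moreover have "b \<notin> odd_rank_set ?M" using ror F by auto
  ultimately have "even (card ?M)" by (simp add: odd_rank_set_def)
  moreover have "\<forall>m\<in>?M. if even (card {j\<in>?M. j < m}) then m \<in> {a} \<union> A else m \<in> B \<union> {b}"
  proof
    fix m assume "m \<in> ?M"
    then have m: "m > 0" "m \<in> F \<longleftrightarrow> m - 1 \<notin> F" unfolding jump_set_def by blast+
    have rank: "even (card {j\<in>?M. j < m}) \<longleftrightarrow> m - 1 \<notin> F"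
      using pred_mem_odd_rank_set[OF m(1), of ?M] ror by simp
    have "m \<in> {a..b}" using sub \<open>m \<in> ?M\<close> by blast
    then have pos: "m = a \<or> m = b \<or> m \<in> {a<..<b}" by auto
    \<comment> \<open>Hence a jump at \<open>a\<close> can only enter \<open>F\<close> and a jump at
      \<open>b\<close> can only leave it. With \<open>a = 0\<close> the truncated
      \<open>a - 1\<close> would be \<open>a\<close> itself.\<close>
    have "a - 1 \<notin> {a..<b}" "b \<notin> {a..<b}" using assms(2) by auto
    then have "a - 1 \<notin> F" "b \<notin> F" using F by blast+
    then show "if even (card {j\<in>?M. j < m}) then m \<in> {a} \<union> A else m \<in> B \<union> {b}"
      unfolding rank using pos s[of m] m(2) by (cases "m \<in> F") auto
  qed
  ultimately show ?thesis
    unfolding alternating_matching_iff_rank using fin sub by (intro conjI)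
qed

lemma chi_alternating_matchings_eq:
  assumes "1 \<le> a"
  shows "{chi M |M. alternating_matching (a, b, A, B) M} = step_vec ` step_sets (a, b, A, B)"
proof (intro equalityI subsetI)
  fix v assume "v \<in> {chi M |M. alternating_matching (a, b, A, B) M}"
  then obtain M where M: "v = chi M" "alternating_matching (a, b, A, B) M" by blast
  then have "v = step_vec (odd_rank_set M)"
    using assms by (subst M(1), intro chi_eq_step_vec) (auto simp: alternating_matching_iff_rank)
  then show "v \<in> step_vec ` step_sets (a, b, A, B)"
    using alternating_matching_odd_rank_set[OF M(2)] by blast
next
  fix v assume "v \<in> step_vec ` step_sets (a, b, A, B)"
  then obtain F where F: "v = step_vec F" "F \<in> step_sets (a, b, A, B)" by blast
  note M = alternating_matching_jump_set[OF F(2) assms]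
  have "odd_rank_set (jump_set F) = F"
    using F(2) assms by (intro odd_rank_set_jump_set) (auto simp: step_sets_def)
  then have "v = step_vec (odd_rank_set (jump_set F))" using F(1) by simp
  also have "\<dots> = chi (jump_set F)"
    using M assms by (intro chi_eq_step_vec[symmetric]) (auto simp: alternating_matching_iff_rank)
  finally show "v \<in> {chi M |M. alternating_matching (a, b, A, B) M}"
    using M by blast
qed

lemma SP_eq_convex_hull_step_vec:
  assumes "1 \<le> a"
  shows "SP (a, b, A, B) = convex hull (step_vec ` step_sets (a, b, A, B))"
  unfolding SP_def chi_alternating_matchings_eq[OF assms] ..

section \<open>Cutting a step set at a point\<close>

lemma step_sets_split:
  assumes "x \<in> {a<..<b}"
  shows "F \<in> step_sets (a, b, A, B) \<longleftrightarrow>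
    (\<exists>G\<in>step_sets (a, x, A \<inter> {a<..<x}, B \<inter> {a<..<x}).
     \<exists>H\<in>step_sets (x, b, A \<inter> {x<..<b}, B \<inter> {x<..<b}).
       F = G \<union> H \<and> (x \<in> H \<and> x - 1 \<notin> G \<longrightarrow> x \<in> A) \<and> (x \<notin> H \<and> x - 1 \<in> G \<longrightarrow> x \<in> B))"
    (is "_ \<longleftrightarrow> ?R")
proof
  assume F: "F \<in> step_sets (a, b, A, B)"
  have "F \<inter> {a..<x} \<in> step_sets (a, x, A \<inter> {a<..<x}, B \<inter> {a<..<x})"
    "F \<inter> {x..<b} \<in> step_sets (x, b, A \<inter> {x<..<b}, B \<inter> {x<..<b})"
    using F assms by (auto simp: step_sets_def)
  moreover have "F = (F \<inter> {a..<x}) \<union> (F \<inter> {x..<b})"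
    using F by (auto simp: step_sets_def)
  moreover have "(x \<in> F \<inter> {x..<b} \<and> x - 1 \<notin> F \<inter> {a..<x} \<longrightarrow> x \<in> A) \<and>
      (x \<notin> F \<inter> {x..<b} \<and> x - 1 \<in> F \<inter> {a..<x} \<longrightarrow> x \<in> B)"
    using F assms by (auto simp: step_sets_def)
  ultimately show ?R by blast
next
  assume ?R
  then obtain G H where G: "G \<in> step_sets (a, x, A \<inter> {a<..<x}, B \<inter> {a<..<x})"
    and H: "H \<in> step_sets (x, b, A \<inter> {x<..<b}, B \<inter> {x<..<b})" and F: "F = G \<union> H"
    and x: "x \<in> H \<and> x - 1 \<notin> G \<longrightarrow> x \<in> A" "x \<notin> H \<and> x - 1 \<in> G \<longrightarrow> x \<in> B"
    by blast
  have sub: "G \<subseteq> {a..<x}" "H \<subseteq> {x..<b}" using G H by (auto simp: step_sets_def)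
  \<comment> \<open>The condition at \<open>i\<close> compares only \<open>i\<close> and
    \<open>i - 1\<close>. Both lie on the same side of the cut unless \<open>i = x\<close>, where it
    becomes the coupling condition between \<open>G\<close> and \<open>H\<close>.\<close>
  have "(i \<in> F \<and> i - 1 \<notin> F \<longrightarrow> i \<in> A) \<and> (i \<notin> F \<and> i - 1 \<in> F \<longrightarrow> i \<in> B)" if i: "i \<in> {a<..<b}" for i
  proof -
    consider "i < x" | "i = x" | "i > x" by linarith
    then show ?thesis
    proof cases
      case 1
      then have "i \<notin> {x..<b}" "i - 1 \<notin> {x..<b}" by auto
      then have "i \<notin> H" "i - 1 \<notin> H" using sub by blast+
      then show ?thesis using G i 1 F by (auto simp: step_sets_def)
    next
      case 2
      then have "i \<notin> {a..<x}" "i - 1 \<notin> {x..<b}" using i by auto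
      then have "i \<notin> G" "i - 1 \<notin> H" using sub by blast+
      then show ?thesis using x F 2 by auto
    next
      case 3
      then have "i \<notin> {a..<x}" "i - 1 \<notin> {a..<x}" by auto
      then have "i \<notin> G" "i - 1 \<notin> G" using sub by blast+
      then show ?thesis using H i 3 F by (auto simp: step_sets_def)
    qed
  qed
  moreover have "F \<subseteq> {a..<b}" using F sub assms by force
  ultimately show "F \<in> step_sets (a, b, A, B)" by (simp add: step_sets_def)
qed

lemma step_vec_split:
  assumes "G \<in> step_sets (a, x, A, B)" "H \<in> step_sets (x, b, C, D)"
  shows "step_vec (G \<union> H) = step_vec G + step_vec H"
proof -
  have sub: "G \<subseteq> {a..<x}" "H \<subseteq> {x..<b}" using assms by (auto simp: step_sets_def)
  then have "finite G" "finite H" "G \<inter> H = {}" using finite_subset by fastforce+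
  then show ?thesis unfolding step_vec_def by (intro sum.union_disjoint)
qed

section \<open>The exchange at the cut\<close>

theorem theorem57:
  fixes a b x :: nat and A B :: "nat set"
  assumes "(a, b, A, B) \<in> arcs CARD('n::finite)"
    and "b - a \<ge> 2"
    and "x \<in> {a<..<b}"
  shows "(SP (a, b, A \<union> {x}, B - {x}) :: (real ^ 'n) set) + SP (a, b, A - {x}, B \<union> {x}) =
    SP (a, b, A - {x}, B - {x})
    + SP (a, x, A \<inter> {a<..<x}, B \<inter> {a<..<x})
    + SP (x, b, A \<inter> {x<..<b}, B \<inter> {x<..<b})"
proof -
  define L R where "L = step_sets (a, x, A \<inter> {a<..<x}, B \<inter> {a<..<x})"
    and "R = step_sets (x, b, A \<inter> {x<..<b}, B \<inter> {x<..<b})"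
  let ?v = "step_vec :: nat set \<Rightarrow> real ^ 'n"
  \<comment> \<open>The predicate \<open>P\<close> sees only the states just before and just after
    the cut. The three quadruples from \<open>a\<close> to \<open>b\<close> share \<open>L\<close>
    and \<open>R\<close> and differ only in \<open>P\<close>.\<close>
  define V where "V P = {?v G + ?v H |G H. G \<in> L \<and> H \<in> R \<and> P (x - 1 \<in> G) (x \<in> H)}" for P
  have VI: "?v G + ?v H \<in> V P" if "G \<in> L" "H \<in> R" "P (x - 1 \<in> G) (x \<in> H)" for G H P
    using that by (auto simp: V_def)
  have split: "?v (G \<union> H) = ?v G + ?v H" if "G \<in> L" "H \<in> R" for G H
    using step_vec_split that unfolding L_def R_def by blast
  have a: "1 \<le> a" "1 \<le> x" using assms by (auto simp: arcs_def)
  have restrict: "(S \<union> {x}) \<inter> {a<..<x} = S \<inter> {a<..<x}" "(S - {x}) \<inter> {a<..<x} = S \<inter> {a<..<x}"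
    "(S \<union> {x}) \<inter> {x<..<b} = S \<inter> {x<..<b}" "(S - {x}) \<inter> {x<..<b} = S \<inter> {x<..<b}" for S
    by auto
  have V: "?v ` step_sets (a, b, S, T) = V (\<lambda>p q. (q \<and> \<not> p \<longrightarrow> x \<in> S) \<and> (\<not> q \<and> p \<longrightarrow> x \<in> T))"
    if ST: "S \<inter> {a<..<x} = A \<inter> {a<..<x}" "S \<inter> {x<..<b} = A \<inter> {x<..<b}"
      "T \<inter> {a<..<x} = B \<inter> {a<..<x}" "T \<inter> {x<..<b} = B \<inter> {x<..<b}" for S T
  proof (intro equalityI subsetI)
    fix w assume "w \<in> ?v ` step_sets (a, b, S, T)"
    then obtain F where F: "F \<in> step_sets (a, b, S, T)" and w: "w = ?v F" by blast
    obtain G H where GH: "G \<in> L" "H \<in> R" "F = G \<union> H"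
      and c: "(x \<in> H \<and> x - 1 \<notin> G \<longrightarrow> x \<in> S) \<and> (x \<notin> H \<and> x - 1 \<in> G \<longrightarrow> x \<in> T)"
      using F unfolding step_sets_split[OF assms(3)] ST L_def[symmetric] R_def[symmetric] by blast
    show "w \<in> V (\<lambda>p q. (q \<and> \<not> p \<longrightarrow> x \<in> S) \<and> (\<not> q \<and> p \<longrightarrow> x \<in> T))"
      unfolding w GH(3) split[OF GH(1,2)] by (rule VI[OF GH(1,2)]) (rule c)
  next
    fix w assume "w \<in> V (\<lambda>p q. (q \<and> \<not> p \<longrightarrow> x \<in> S) \<and> (\<not> q \<and> p \<longrightarrow> x \<in> T))"
    then obtain G H where GH: "G \<in> L" "H \<in> R" and w: "w = ?v G + ?v H"
      and c: "x \<in> H \<and> x - 1 \<notin> G \<longrightarrow> x \<in> S" "x \<notin> H \<and> x - 1 \<in> G \<longrightarrow> x \<in> T"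
      unfolding V_def by blast
    have "G \<union> H \<in> step_sets (a, b, S, T)"
      unfolding step_sets_split[OF assms(3)] ST L_def[symmetric] R_def[symmetric]
      by (rule bexI[of _ G], rule bexI[of _ H]) (intro conjI refl c GH)+
    then show "w \<in> ?v ` step_sets (a, b, S, T)"
      unfolding w split[OF GH, symmetric] by (rule imageI)
  qed
  \<comment> \<open>With \<open>p\<close> the state before and \<open>q\<close> the state after the
    cut, forbidding to leave at \<open>x\<close> means \<open>p \<longrightarrow> q\<close>,
    forbidding to enter means \<open>q \<longrightarrow> p\<close>, and forbidding both means
    \<open>p = q\<close>.\<close>
  have VA: "?v ` step_sets (a, b, A \<union> {x}, B - {x}) = V (\<lambda>p q. p \<longrightarrow> q)"
    by (subst V) (auto simp: restrict intro!: arg_cong[where f = V])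
  have VB: "?v ` step_sets (a, b, A - {x}, B \<union> {x}) = V (\<lambda>p q. q \<longrightarrow> p)"
    by (subst V) (auto simp: restrict intro!: arg_cong[where f = V])
  have V0: "?v ` step_sets (a, b, A - {x}, B - {x}) = V (\<lambda>p q. p = q)"
    by (subst V) (auto simp: restrict intro!: arg_cong[where f = V])
  have "V (\<lambda>p q. p \<longrightarrow> q) + V (\<lambda>p q. q \<longrightarrow> p) = V (\<lambda>p q. p = q) + ?v ` L + ?v ` R"
  proof (intro equalityI subsetI)
    fix w assume "w \<in> V (\<lambda>p q. p \<longrightarrow> q) + V (\<lambda>p q. q \<longrightarrow> p)"
    then obtain u u' where w: "w = u + u'" and u: "u \<in> V (\<lambda>p q. p \<longrightarrow> q)" "u' \<in> V (\<lambda>p q. q \<longrightarrow> p)"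
      by (rule set_plus_elim)
    from u(1) obtain G H where GH: "u = ?v G + ?v H" "G \<in> L" "H \<in> R" "x - 1 \<in> G \<longrightarrow> x \<in> H"
      unfolding V_def by blast
    from u(2) obtain G' H' where GH': "u' = ?v G' + ?v H'" "G' \<in> L" "H' \<in> R" "x \<in> H' \<longrightarrow> x - 1 \<in> G'"
      unfolding V_def by blast
    \<comment> \<open>If the first two cases fail, then \<open>F\<close> is entered and
      \<open>F'\<close> is left at \<open>x\<close>, so \<open>x - 1\<close> is not in
      \<open>G\<close> and \<open>x\<close> is not in \<open>H'\<close>: the third case
      holds.\<close>
    consider "x - 1 \<in> G \<longleftrightarrow> x \<in> H" | "x - 1 \<in> G' \<longleftrightarrow> x \<in> H'" | "x - 1 \<in> G \<longleftrightarrow> x \<in> H'"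
      using GH(4) GH'(4) by blast
    then obtain G1 H1 G2 H2 where eq: "w = (?v G1 + ?v H1) + ?v G2 + ?v H2"
      and in_L: "G1 \<in> L" "G2 \<in> L" and in_R: "H1 \<in> R" "H2 \<in> R"
      and const: "x - 1 \<in> G1 \<longleftrightarrow> x \<in> H1"
    proof cases
      case 1
      show ?thesis
        by (rule that[OF _ GH(2) GH'(2) GH(3) GH'(3) 1]) (simp add: w GH(1) GH'(1) ac_simps)
    next
      case 2
      show ?thesis
        by (rule that[OF _ GH'(2) GH(2) GH'(3) GH(3) 2]) (simp add: w GH(1) GH'(1) ac_simps)
    next
      case 3
      \<comment> \<open>The exchange: \<open>G\<close> is paired with \<open>H'\<close>, and
        \<open>G'\<close> and \<open>H\<close> become the free summands.\<close>
      show ?thesis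
        by (rule that[OF _ GH(2) GH'(2) GH'(3) GH(3) 3]) (simp add: w GH(1) GH'(1) ac_simps)
    qed
    show "w \<in> V (\<lambda>p q. p = q) + ?v ` L + ?v ` R"
      unfolding eq by (intro set_plus_intro imageI in_L in_R VI const)
  next
    fix w assume "w \<in> V (\<lambda>p q. p = q) + ?v ` L + ?v ` R"
    then obtain u G' H' where w: "w = u + ?v G' + ?v H'" and u: "u \<in> V (\<lambda>p q. p = q)"
      and GH': "G' \<in> L" "H' \<in> R"
      by (blast elim: set_plus_elim)
    from u obtain G H where GH: "u = ?v G + ?v H" "G \<in> L" "H \<in> R" "x - 1 \<in> G \<longleftrightarrow> x \<in> H"
      unfolding V_def by blast
    \<comment> \<open>Being constant at \<open>x\<close>, \<open>u\<close> fits either summand, so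
      it can take the one that the pair \<open>G'\<close>, \<open>H'\<close> leaves open.\<close>
    have up: "u \<in> V (\<lambda>p q. p \<longrightarrow> q)" and down: "u \<in> V (\<lambda>p q. q \<longrightarrow> p)"
      unfolding GH(1) by (rule VI[OF GH(2,3)], use GH(4) in blast)+
    show "w \<in> V (\<lambda>p q. p \<longrightarrow> q) + V (\<lambda>p q. q \<longrightarrow> p)"
    proof (cases "x - 1 \<in> G' \<longrightarrow> x \<in> H'")
      case True
      have "(?v G' + ?v H') + u \<in> V (\<lambda>p q. p \<longrightarrow> q) + V (\<lambda>p q. q \<longrightarrow> p)"
        by (rule set_plus_intro[OF VI[OF GH'] down]) (rule True)
      then show ?thesis unfolding w by (simp only: ac_simps)
    next
      case False
      have "u + (?v G' + ?v H') \<in> V (\<lambda>p q. p \<longrightarrow> q) + V (\<lambda>p q. q \<longrightarrow> p)"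
        by (rule set_plus_intro[OF up VI[OF GH']]) (use False in blast)
      then show ?thesis unfolding w by (simp only: ac_simps)
    qed
  qed
  \<comment> \<open>Convex hulls commute with Minkowski sums, which carries the identity over from
    the generating sets.\<close>
  then show ?thesis
    unfolding SP_eq_convex_hull_step_vec[OF a(1)] SP_eq_convex_hull_step_vec[OF a(2)]
      VA VB V0 convex_hull_set_plus[symmetric] L_def[symmetric] R_def[symmetric] by simp
qed

end
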